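(* $W^*(n)=\Omega(n)$; that is, there is a constant $c>0$ such that $W^*(n)\ge c\,n$ for all sufficiently large $n$. Consequently also $W(n)=\Omega(n)$.
   Context: Graphs are finite simple graphs, viewed as structures with one binary adjacency relation $E$ and equality. $\chi(G)$ is the chromatic number and $K_3$ the complete graph on 3 vertices. The width of a first-order formula is the number of distinct variables occurring in it (repeated occurrences of the same variable count once). For graphs $G,H$, $W^*(G,H)$ is the minimum width of a first-order sentence (no restrictions on connectives or quantifiers) that is true in $G$ and false in $H$. Define $W^*(n)=\max\{W^*(G,H): |V(G)|=|V(H)|=n,\ \chi(G)>3,\ \chi(H)\le 3\}$. For a graph $G$ with $\chi(G)>3$, $W(G)$ is the least $k$ such that some existential-positive first-order sentence (built from atomic formulas $x=y$, $E(x,y)$ using only $\wedge$, $\vee$ and $\exists$) of width at most $k$ is true in $G$ and false in $K_3$. Define $W(n)=\max\{W(G): |V(G)|=n,\ \chi(G)>3\}$. *)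

theory Defs
  imports Complex_Main
begin

definition is_graph :: "'v set \<Rightarrow> ('v \<Rightarrow> 'v \<Rightarrow> bool) \<Rightarrow> bool" where
  "is_graph V E \<longleftrightarrow> finite V \<and> (\<forall>u v. E u v \<longrightarrow> u \<in> V \<and> v \<in> V)
     \<and> (\<forall>u v. E u v \<longrightarrow> E v u) \<and> (\<forall>u. \<not> E u u)"

definition colorable :: "'v set \<Rightarrow> ('v \<Rightarrow> 'v \<Rightarrow> bool) \<Rightarrow> nat \<Rightarrow> bool" where
  "colorable V E k \<longleftrightarrow> (\<exists>c :: 'v \<Rightarrow> nat. (\<forall>v\<in>V. c v < k)
     \<and> (\<forall>u\<in>V. \<forall>v\<in>V. E u v \<longrightarrow> c u \<noteq> c v))"

definition chromatic_number :: "'v set \<Rightarrow> ('v \<Rightarrow> 'v \<Rightarrow> bool) \<Rightarrow> nat" where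
  "chromatic_number V E = (LEAST k. colorable V E k)"

definition K3_V :: "nat set" where "K3_V = {0,1,2}"
definition K3_E :: "nat \<Rightarrow> nat \<Rightarrow> bool" where
  "K3_E u v \<longleftrightarrow> u \<in> K3_V \<and> v \<in> K3_V \<and> u \<noteq> v"

datatype fm =
    FEq nat nat
  | FEdge nat nat
  | FTrue
  | FFalse
  | FNot fm
  | FAnd fm fm
  | FOr fm fm
  | FImp fm fm
  | FIff fm fm
  | FEx nat fm
  | FAll nat fm

fun vars :: "fm \<Rightarrow> nat set" where
  "vars (FEq x y) = {x, y}"
| "vars (FEdge x y) = {x, y}"
| "vars FTrue = {}"
| "vars FFalse = {}"
| "vars (FNot p) = vars p"
| "vars (FAnd p q) = vars p \<union> vars q"
| "vars (FOr p q) = vars p \<union> vars q"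
| "vars (FImp p q) = vars p \<union> vars q"
| "vars (FIff p q) = vars p \<union> vars q"
| "vars (FEx x p) = insert x (vars p)"
| "vars (FAll x p) = insert x (vars p)"

fun freevars :: "fm \<Rightarrow> nat set" where
  "freevars (FEq x y) = {x, y}"
| "freevars (FEdge x y) = {x, y}"
| "freevars FTrue = {}"
| "freevars FFalse = {}"
| "freevars (FNot p) = freevars p"
| "freevars (FAnd p q) = freevars p \<union> freevars q"
| "freevars (FOr p q) = freevars p \<union> freevars q"
| "freevars (FImp p q) = freevars p \<union> freevars q"
| "freevars (FIff p q) = freevars p \<union> freevars q"
| "freevars (FEx x p) = freevars p - {x}"
| "freevars (FAll x p) = freevars p - {x}"

definition width :: "fm \<Rightarrow> nat" where
  "width p = card (vars p)"

definition sentence :: "fm \<Rightarrow> bool" where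
  "sentence p \<longleftrightarrow> freevars p = {}"

fun ep :: "fm \<Rightarrow> bool" where
  "ep (FEq x y) = True"
| "ep (FEdge x y) = True"
| "ep (FAnd p q) = (ep p \<and> ep q)"
| "ep (FOr p q) = (ep p \<and> ep q)"
| "ep (FEx x p) = ep p"
| "ep _ = False"

fun sat :: "'v set \<Rightarrow> ('v \<Rightarrow> 'v \<Rightarrow> bool) \<Rightarrow> (nat \<Rightarrow> 'v) \<Rightarrow> fm \<Rightarrow> bool" where
  "sat V E a (FEq x y) = (a x = a y)"
| "sat V E a (FEdge x y) = E (a x) (a y)"
| "sat V E a FTrue = True"
| "sat V E a FFalse = False"
| "sat V E a (FNot p) = (\<not> sat V E a p)"
| "sat V E a (FAnd p q) = (sat V E a p \<and> sat V E a q)"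
| "sat V E a (FOr p q) = (sat V E a p \<or> sat V E a q)"
| "sat V E a (FImp p q) = (sat V E a p \<longrightarrow> sat V E a q)"
| "sat V E a (FIff p q) = (sat V E a p \<longleftrightarrow> sat V E a q)"
| "sat V E a (FEx x p) = (\<exists>v\<in>V. sat V E (a(x := v)) p)"
| "sat V E a (FAll x p) = (\<forall>v\<in>V. sat V E (a(x := v)) p)"

text \<open>Truth of a sentence (the assignment is irrelevant for sentences).\<close>
definition holds :: "'v set \<Rightarrow> ('v \<Rightarrow> 'v \<Rightarrow> bool) \<Rightarrow> fm \<Rightarrow> bool" where
  "holds V E p \<longleftrightarrow> sat V E (\<lambda>_. undefined) p"

definition Wstar_pair :: "'v set \<Rightarrow> ('v \<Rightarrow> 'v \<Rightarrow> bool) \<Rightarrow> 'w set \<Rightarrow> ('w \<Rightarrow> 'w \<Rightarrow> bool) \<Rightarrow> nat" where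
  "Wstar_pair VG EG VH EH = (LEAST k. \<exists>p. sentence p \<and> width p = k \<and> holds VG EG p \<and> \<not> holds VH EH p)"

text \<open>Graphs on n vertices are taken, up to isomorphism, with vertex set {0..<n}.\<close>
definition Wstar :: "nat \<Rightarrow> nat" where
  "Wstar n = Max {Wstar_pair {0..<n} EG {0..<n} EH | EG EH.
      is_graph {0..<n} EG \<and> is_graph {0..<n} EH
      \<and> chromatic_number {0..<n} EG > 3 \<and> chromatic_number {0..<n} EH \<le> 3}"

definition W_graph :: "'v set \<Rightarrow> ('v \<Rightarrow> 'v \<Rightarrow> bool) \<Rightarrow> nat" where
  "W_graph V E = (LEAST k. \<exists>p. sentence p \<and> ep p \<and> width p \<le> k \<and> holds V E p \<and> \<not> holds K3_V K3_E p)"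

definition W :: "nat \<Rightarrow> nat" where
  "W n = Max {W_graph {0..<n} E | E. is_graph {0..<n} E \<and> chromatic_number {0..<n} E > 3}"

end

theory Submission
  imports Defs "HOL-Library.FuncSet"
begin

text \<open>A random system of \<open>2 N\<close> equations \<open>x + y + z = b\<close> over the two-element field in \<open>N\<close>
  variables is expanding: any \<open>r = O(N)\<close> of its equations mention more than \<open>5 r / 3\<close>
  variables. It has more equations than variables, so some right-hand side makes it unsolvable;
  yet by expansion partial assignments of \<open>O(N)\<close> variables can be kept consistent with all
  small sets of equations. Encode the system as a 3-colouring problem on a graph with two
  literal vertices per variable and one clause gadget for each equation and sign pattern. A flip
  of variables permutes literals and gadgets and carries the unsolvable graph \<open>G\<close> to the
  homogeneous, hence 3-colourable, graph \<open>H\<close> wherever the flipping assignment satisfies the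
  equations. So Duplicator wins the pebble game with linearly many pebbles.\<close>

section \<open>First-order logic on graphs\<close>

lemma finite_vars: "finite (vars p)"
  by (induction p) auto

lemma sat_cong: "(\<And>x. x \<in> freevars p \<Longrightarrow> a x = b x) \<Longrightarrow> sat V E a p = sat V E b p"
proof (induction p arbitrary: a b)
  case (FEx x p)
  have "sat V E (a(x := v)) p = sat V E (b(x := v)) p" for v
    by (rule FEx.IH) (use FEx.prems in auto)
  then show ?case by simp
next
  case (FAll x p)
  have "sat V E (a(x := v)) p = sat V E (b(x := v)) p" for v
    by (rule FAll.IH) (use FAll.prems in auto)
  then show ?case by simp
next
  case (FAnd p q)
  have "sat V E a p = sat V E b p" "sat V E a q = sat V E b q"
    by (rule FAnd.IH, simp add: FAnd.prems)+
  then show ?case by simp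
next
  case (FOr p q)
  have "sat V E a p = sat V E b p" "sat V E a q = sat V E b q"
    by (rule FOr.IH, simp add: FOr.prems)+
  then show ?case by simp
next
  case (FImp p q)
  have "sat V E a p = sat V E b p" "sat V E a q = sat V E b q"
    by (rule FImp.IH, simp add: FImp.prems)+
  then show ?case by simp
next
  case (FIff p q)
  have "sat V E a p = sat V E b p" "sat V E a q = sat V E b q"
    by (rule FIff.IH, simp add: FIff.prems)+
  then show ?case by simp
next
  case (FNot p)
  have "sat V E a p = sat V E b p"
    by (rule FNot.IH) (simp add: FNot.prems)
  then show ?case by simp
qed auto

lemma holds_iff_sat: "sentence p \<Longrightarrow> holds V E p = sat V E a p"
  unfolding holds_def sentence_def by (rule sat_cong) simp

text \<open>The pebble game: \<open>R\<close> is a winning strategy for Duplicator in which only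
  variables of \<open>X\<close> carry pebbles. The bound on \<open>vars p\<close> covers bound
  variables too, so requantifying a variable means moving its pebble, and \<open>card X\<close>
  pebbles suffice.\<close>

lemma sat_back_and_forth:
  assumes eq: "\<And>a b x y. R a b \<Longrightarrow> x \<in> X \<Longrightarrow> y \<in> X \<Longrightarrow> (a x = a y) = (b x = b y)"
    and edge: "\<And>a b x y. R a b \<Longrightarrow> x \<in> X \<Longrightarrow> y \<in> X \<Longrightarrow> E (a x) (a y) = E' (b x) (b y)"
    and forth: "\<And>a b x v. R a b \<Longrightarrow> x \<in> X \<Longrightarrow> v \<in> V \<Longrightarrow> \<exists>w\<in>V'. R (a(x := v)) (b(x := w))"
    and backw: "\<And>a b x w. R a b \<Longrightarrow> x \<in> X \<Longrightarrow> w \<in> V' \<Longrightarrow> \<exists>v\<in>V. R (a(x := v)) (b(x := w))"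
    and "vars p \<subseteq> X" "R a b"
  shows "sat V E a p = sat V' E' b p"
  using assms(5,6)
proof (induction p arbitrary: a b)
  case (FEx x p)
  have x: "x \<in> X" and p: "vars p \<subseteq> X" using FEx.prems by auto
  show ?case
    using forth[OF FEx.prems(2) x] backw[OF FEx.prems(2) x] FEx.IH[OF p] by simp blast
next
  case (FAll x p)
  have x: "x \<in> X" and p: "vars p \<subseteq> X" using FAll.prems by auto
  show ?case
    using forth[OF FAll.prems(2) x] backw[OF FAll.prems(2) x] FAll.IH[OF p] by simp blast
qed (use eq edge in auto)

lemma sat_iso:
  assumes h: "bij_betw h V V'"
    and E: "\<And>u v. u \<in> V \<Longrightarrow> v \<in> V \<Longrightarrow> E u v = E' (h u) (h v)"
    and a: "\<And>x. a x \<in> V"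
  shows "sat V E a p = sat V' E' (h \<circ> a) p"
proof (rule sat_back_and_forth[where R = "\<lambda>a b. (\<forall>x. a x \<in> V) \<and> b = h \<circ> a" and X = UNIV])
  have inj: "inj_on h V" and img: "h ` V = V'" using h by (auto simp: bij_betw_def)
  show "\<exists>w\<in>V'. (\<forall>y. (a(x := v)) y \<in> V) \<and> b(x := w) = h \<circ> a(x := v)"
    if "(\<forall>x. a x \<in> V) \<and> b = h \<circ> a" "v \<in> V" for a b x v
    using that img by (intro bexI[of _ "h v"]) auto
  show "\<exists>v\<in>V. (\<forall>y. (a(x := v)) y \<in> V) \<and> b(x := w) = h \<circ> a(x := v)"
    if "(\<forall>x. a x \<in> V) \<and> b = h \<circ> a" "w \<in> V'" for a b x w
  proof -
    from that(2) obtain v where "v \<in> V" "w = h v" using img by blast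
    then show ?thesis using that(1) by (intro bexI[of _ v]) auto
  qed
  show "(a x = a y) = (b x = b y)" if "(\<forall>x. a x \<in> V) \<and> b = h \<circ> a" for a b x y
    using that inj by (auto simp: inj_on_def)
qed (use a E in auto)

text \<open>Equality occurs only positively in \<open>p\<close>, so even a non-injective
  \<open>h\<close> preserves it.\<close>

lemma sat_hom:
  assumes h: "\<And>u. u \<in> V \<Longrightarrow> h u \<in> V'"
    and E: "\<And>u v. u \<in> V \<Longrightarrow> v \<in> V \<Longrightarrow> E u v \<Longrightarrow> E' (h u) (h v)"
  shows "ep p \<Longrightarrow> (\<And>x. a x \<in> V) \<Longrightarrow> sat V E a p \<Longrightarrow> sat V' E' (h \<circ> a) p"
proof (induction p arbitrary: a)
  case (FEx x p)
  then obtain v where v: "v \<in> V" "sat V E (a(x := v)) p" by auto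
  have upd: "(a(x := v)) y \<in> V" for y using FEx.prems(2) v(1) by simp
  have "sat V' E' (h \<circ> a(x := v)) p"
    by (rule FEx.IH[OF _ upd v(2)]) (use FEx.prems(1) in simp)
  also have "h \<circ> a(x := v) = (h \<circ> a)(x := h v)" by auto
  finally show ?case unfolding sat.simps using h[OF v(1)] by blast
qed (use E in auto)

lemma sat_foldr_FEx:
  "sat V E a (foldr FEx xs p) \<longleftrightarrow>
     (\<exists>b. (\<forall>x\<in>set xs. b x \<in> V) \<and> (\<forall>x. x \<notin> set xs \<longrightarrow> b x = a x) \<and> sat V E b p)"
proof (induction xs arbitrary: a)
  case Nil
  have "b = a" if "\<forall>x. b x = a x" for b using that by blast
  then show ?case by auto
next
  case (Cons y xs)
  show ?case (is "?L = ?R")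
  proof
    assume ?L
    then obtain v b where "v \<in> V" "\<forall>x\<in>set xs. b x \<in> V"
      "\<forall>x. x \<notin> set xs \<longrightarrow> b x = (a(y := v)) x" "sat V E b p"
      by (auto simp: Cons.IH)
    then show ?R by (intro exI[of _ b]) (auto split: if_splits)
  next
    assume ?R
    then obtain b where b: "\<forall>x\<in>set (y # xs). b x \<in> V"
      "\<forall>x. x \<notin> set (y # xs) \<longrightarrow> b x = a x" "sat V E b p" by blast
    then have "sat V E (a(y := b y)) (foldr FEx xs p)"
      unfolding Cons.IH by (intro exI[of _ b]) auto
    then show ?L using b(1) by auto
  qed
qed

lemma freevars_foldr_FEx: "freevars (foldr FEx xs p) = freevars p - set xs"
  by (induction xs) auto

lemma ep_foldr_FEx: "ep (foldr FEx xs p) = ep p"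
  by (induction xs) auto

text \<open>The canonical conjunctive query of the graph: one variable per vertex and one atom per
  edge, so its satisfying assignments are the homomorphisms.\<close>

lemma ex_hom_sentence:
  fixes n :: nat
  assumes "is_graph {0..<n} E" and n: "0 < n"
  obtains p where "sentence p" "ep p" "holds {0..<n} E p"
    "\<And>(V' :: 'w set) E'. holds V' E' p \<Longrightarrow>
       \<exists>h. (\<forall>u<n. h u \<in> V') \<and> (\<forall>u v. E u v \<longrightarrow> E' (h u) (h v))"
proof -
  have sub: "{(u, v). E u v} \<subseteq> {0..<n} \<times> {0..<n}"
    using assms(1) by (auto simp: is_graph_def)
  then have "finite {(u, v). E u v}" by (rule finite_subset) (intro finite_cartesian_product finite_atLeastLessThan)
  then obtain es where es: "set es = {(u, v). E u v}" using finite_list by blast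
  \<comment> \<open>\<open>ep\<close> excludes \<open>FTrue\<close>, hence \<open>FEq 0 0\<close> as
    the neutral conjunct. Its variable 0 must be among those quantified, which is where
    \<open>0 < n\<close> enters.\<close>
  define q where "q = foldr FAnd (map (\<lambda>(u, v). FEdge u v) es) (FEq 0 0)"
  define p where "p = foldr FEx [0..<n] q"
  have q_sat: "sat V' E' a q \<longleftrightarrow> (\<forall>(u, v)\<in>set es. E' (a u) (a v))"
    for V' :: "'u set" and E' a
    unfolding q_def by (induction es) auto
  have q_ep: "ep q" unfolding q_def by (induction es) auto
  have "freevars q \<subseteq> insert 0 (fst ` set es \<union> snd ` set es)"
    unfolding q_def by (induction es) auto
  also have "\<dots> \<subseteq> {0..<n}" using n sub es by fastforce
  finally have p_sent: "sentence p"
    unfolding sentence_def p_def freevars_foldr_FEx by auto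
  show ?thesis
  proof
    show "sentence p" by (rule p_sent)
    show "ep p" using q_ep by (simp add: p_def ep_foldr_FEx)
    have "sat {0..<n} E id p"
      unfolding p_def sat_foldr_FEx by (intro exI[of _ id]) (auto simp: q_sat es)
    then show "holds {0..<n} E p" by (simp add: holds_iff_sat[OF p_sent, where a = id])
    show "\<exists>h. (\<forall>u<n. h u \<in> V') \<and> (\<forall>u v. E u v \<longrightarrow> E' (h u) (h v))"
      if "holds V' E' p" for V' :: "'w set" and E'
    proof -
      from that obtain b where b: "\<forall>x\<in>{0..<n}. b x \<in> V'" "sat V' E' b q"
        unfolding holds_def p_def sat_foldr_FEx set_upt by blast
      then show ?thesis by (intro exI[of _ b]) (auto simp: q_sat es)
    qed
  qed
qed

section \<open>Colourability, and reduction of both widths to one pair of graphs\<close>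

lemma colorable_mono: "colorable V E k \<Longrightarrow> k \<le> l \<Longrightarrow> colorable V E l"
  unfolding colorable_def by (meson less_le_trans)

lemma colorable_card:
  assumes "is_graph V E" shows "colorable V E (card V)"
proof -
  have "finite V" using assms by (simp add: is_graph_def)
  then obtain h where h: "bij_betw h V {0..<card V}" using ex_bij_betw_finite_nat by blast
  then have "inj_on h V" "h ` V = {0..<card V}" by (auto simp: bij_betw_def)
  then have "h v < card V" "u \<in> V \<Longrightarrow> h u = h v \<Longrightarrow> u = v" if "v \<in> V" for u v
    using that by (auto simp: inj_on_def)
  then show ?thesis
    using assms unfolding colorable_def is_graph_def by (intro exI[of _ h]) blast
qed

lemma chromatic_number_le_iff:
  assumes "is_graph V E" shows "chromatic_number V E \<le> k \<longleftrightarrow> colorable V E k"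
proof
  have "colorable V E (chromatic_number V E)"
    unfolding chromatic_number_def using colorable_card[OF assms] by (rule LeastI)
  then show "colorable V E k" if "chromatic_number V E \<le> k"
    using that by (rule colorable_mono)
  show "chromatic_number V E \<le> k" if "colorable V E k"
    unfolding chromatic_number_def using that by (rule Least_le)
qed

lemma hom_K3_imp_colorable:
  assumes "\<And>u. u \<in> V \<Longrightarrow> h u \<in> K3_V" "\<And>u v. E u v \<Longrightarrow> K3_E (h u) (h v)"
  shows "colorable V E 3"
  unfolding colorable_def
  using assms by (intro exI[of _ h]) (fastforce simp: K3_V_def K3_E_def)

lemma finite_graphs:
  assumes "finite V" shows "finite {E. is_graph V E}"
proof (rule finite_subset)
  show "{E. is_graph V E} \<subseteq> (\<lambda>A u v. (u, v) \<in> A) ` Pow (V \<times> V)"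
  proof
    fix E assume "E \<in> {E. is_graph V E}"
    then have "{(u, v). E u v} \<in> Pow (V \<times> V)" by (auto simp: is_graph_def)
    moreover have "E = (\<lambda>u v. (u, v) \<in> {(u, v). E u v})" by simp
    ultimately show "E \<in> (\<lambda>A u v. (u, v) \<in> A) ` Pow (V \<times> V)" by (rule rev_image_eqI)
  qed
qed (use assms in simp)

text \<open>The minimal widths are attained because mapping \<open>G\<close> homomorphically is
  expressible with \<open>n\<close> variables; a sentence that witnesses the width of \<open>G\<close> against
  \<open>K\<^sub>3\<close> also separates \<open>G\<close> from the 3-colourable graph \<open>H\<close>.\<close>

lemma Wstar_W_lower_bound:
  assumes G: "is_graph {0..<n} EG" "\<not> colorable {0..<n} EG 3"
    and H: "is_graph {0..<n} EH" "colorable {0..<n} EH 3"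
    and width: "\<And>p. sentence p \<Longrightarrow> holds {0..<n} EG p \<Longrightarrow> \<not> holds {0..<n} EH p \<Longrightarrow> k \<le> width p"
  shows "k \<le> Wstar n" "k \<le> W n"
proof -
  have n: "0 < n"
    using G(2) by (rule contrapos_np) (simp add: colorable_def)
  obtain c :: "nat \<Rightarrow> nat" where c: "\<And>v. v \<in> {0..<n} \<Longrightarrow> c v < 3"
    "\<And>u v. u \<in> {0..<n} \<Longrightarrow> v \<in> {0..<n} \<Longrightarrow> EH u v \<Longrightarrow> c u \<noteq> c v"
    using H(2) unfolding colorable_def by blast
  have c_hom: "c u \<in> K3_V" if "u \<in> {0..<n}" for u
    using c(1)[OF that] by (auto simp: K3_V_def)
  have c_edge: "K3_E (c u) (c v)" if "u \<in> {0..<n}" "v \<in> {0..<n}" "EH u v" for u v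
    using c_hom c(2) that by (simp add: K3_E_def)
  have K3_H: "holds K3_V K3_E p" if p: "sentence p" "ep p" "holds {0..<n} EH p" for p
  proof -
    have "sat {0..<n} EH (\<lambda>_. 0) p" using p(3) holds_iff_sat[OF p(1)] by metis
    then have "sat K3_V K3_E (c \<circ> (\<lambda>_. 0)) p"
      using sat_hom[of "{0..<n}" c K3_V EH K3_E p "\<lambda>_. 0"] c_hom c_edge p(2) n by simp
    then show ?thesis using holds_iff_sat[OF p(1)] by metis
  qed
  obtain p :: fm where p: "sentence p" "ep p" "holds {0..<n} EG p"
    and p_hom: "\<And>(V' :: nat set) E'. holds V' E' p \<Longrightarrow>
       \<exists>h. (\<forall>u<n. h u \<in> V') \<and> (\<forall>u v. EG u v \<longrightarrow> E' (h u) (h v))"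
    using ex_hom_sentence[OF G(1) n, where 'w = nat] by metis
  have p_K3: "\<not> holds K3_V K3_E p"
    using p_hom[of K3_V K3_E] G(2) hom_K3_imp_colorable[of "{0..<n}" _ EG] by auto
  have p_H: "\<not> holds {0..<n} EH p" using p_K3 K3_H p by blast
  have "\<exists>k p. sentence p \<and> width p = k \<and> holds {0..<n} EG p \<and> \<not> holds {0..<n} EH p"
    using p p_H by blast
  from LeastI_ex[OF this] have "k \<le> Wstar_pair {0..<n} EG {0..<n} EH"
    unfolding Wstar_pair_def using width by metis
  also have "\<dots> \<le> Wstar n"
    unfolding Wstar_def
  proof (rule Max_ge)
    show "finite {Wstar_pair {0..<n} EG {0..<n} EH | EG EH.
      is_graph {0..<n} EG \<and> is_graph {0..<n} EH
      \<and> chromatic_number {0..<n} EG > 3 \<and> chromatic_number {0..<n} EH \<le> 3}"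
      by (rule finite_subset[of _ "(\<lambda>(EG, EH). Wstar_pair {0..<n} EG {0..<n} EH) `
            ({E. is_graph {0..<n} E} \<times> {E. is_graph {0..<n} E})"])
         (auto simp: finite_graphs)
    have "3 < chromatic_number {0..<n} EG" "chromatic_number {0..<n} EH \<le> 3"
      using G H chromatic_number_le_iff not_le by metis+
    then show "Wstar_pair {0..<n} EG {0..<n} EH \<in> {Wstar_pair {0..<n} EG {0..<n} EH | EG EH.
      is_graph {0..<n} EG \<and> is_graph {0..<n} EH
      \<and> chromatic_number {0..<n} EG > 3 \<and> chromatic_number {0..<n} EH \<le> 3}"
      using G(1) H(1) by blast
  qed
  finally show "k \<le> Wstar n" .
  have "\<exists>l p. sentence p \<and> ep p \<and> width p \<le> l \<and> holds {0..<n} EG p \<and> \<not> holds K3_V K3_E p"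
    using p p_K3 by blast
  from LeastI_ex[OF this] obtain q where "sentence q" "ep q"
    "width q \<le> W_graph {0..<n} EG" "holds {0..<n} EG q" "\<not> holds K3_V K3_E q"
    unfolding W_graph_def by blast
  then have "k \<le> W_graph {0..<n} EG"
    using width[of q] K3_H[of q] by (meson le_trans)
  also have "\<dots> \<le> W n"
    unfolding W_def
  proof (rule Max_ge)
    show "finite {W_graph {0..<n} E | E. is_graph {0..<n} E \<and> chromatic_number {0..<n} E > 3}"
      by (rule finite_subset[of _ "W_graph {0..<n} ` {E. is_graph {0..<n} E}"])
         (auto simp: finite_graphs)
    have "3 < chromatic_number {0..<n} EG"
      using G chromatic_number_le_iff not_le by metis
    then show "W_graph {0..<n} EG \<in>
        {W_graph {0..<n} E | E. is_graph {0..<n} E \<and> chromatic_number {0..<n} E > 3}"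
      using G(1) by blast
  qed
  finally show "k \<le> W n" .
qed

text \<open>Transfers the bound from an arbitrary vertex type to \<open>{0..<n}\<close> by pulling
  both edge relations back along one bijection.\<close>

lemma Wstar_W_lower_bound_iso:
  fixes V :: "'v set"
  assumes G: "is_graph V EG" "\<not> colorable V EG 3"
    and H: "is_graph V EH" "colorable V EH 3"
    and width: "\<And>p. sentence p \<Longrightarrow> holds V EG p \<Longrightarrow> \<not> holds V EH p \<Longrightarrow> k \<le> width p"
  shows "k \<le> Wstar (card V)" "k \<le> W (card V)"
proof -
  let ?V = "{0..<card V}"
  have fin: "finite V" using G(1) by (simp add: is_graph_def)
  obtain g where g: "bij_betw g ?V V" using ex_bij_betw_nat_finite[OF fin] by blast
  have inj: "inj_on g ?V" and img: "g ` ?V = V" using g by (auto simp: bij_betw_def)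
  have g_in: "g u \<in> V" if "u < card V" for u using img that by auto
  define pull where "pull E u v \<longleftrightarrow> u \<in> ?V \<and> v \<in> ?V \<and> E (g u) (g v)" for E :: "'v \<Rightarrow> 'v \<Rightarrow> bool" and u v
  have pull_graph: "is_graph ?V (pull E)" if "is_graph V E" for E
    using that by (auto simp: is_graph_def pull_def)
  have pull_col: "colorable ?V (pull E) 3 = colorable V E 3" for E
  proof
    assume "colorable V E 3"
    then obtain c where c: "\<forall>v\<in>V. c v < (3 :: nat)" "\<forall>u\<in>V. \<forall>v\<in>V. E u v \<longrightarrow> c u \<noteq> c v"
      unfolding colorable_def by blast
    then show "colorable ?V (pull E) 3"
      unfolding colorable_def using g_in
      by (intro exI[of _ "c \<circ> g"]) (auto simp: pull_def)
  next
    let ?g = "the_inv_into ?V g"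
    assume "colorable ?V (pull E) 3"
    then obtain c where c: "\<forall>v\<in>?V. c v < (3 :: nat)" "\<forall>u\<in>?V. \<forall>v\<in>?V. pull E u v \<longrightarrow> c u \<noteq> c v"
      unfolding colorable_def by blast
    have "?g v \<in> ?V" "g (?g v) = v" if "v \<in> V" for v
      using the_inv_into_into[OF inj _ subset_refl] f_the_inv_into_f[OF inj] that img by auto
    then show "colorable V E 3"
      unfolding colorable_def using c
      by (intro exI[of _ "c \<circ> ?g"]) (auto simp: pull_def)
  qed
  have "V \<noteq> {}" using G(2) by (auto simp: colorable_def)
  then have "0 \<in> ?V" using fin by (auto simp: card_gt_0_iff)
  have pull_holds: "holds ?V (pull E) p = holds V E p" if p: "sentence p" for E p
  proof -
    have "sat ?V (pull E) (\<lambda>_. 0) p = sat V E (g \<circ> (\<lambda>_. 0)) p"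
      by (rule sat_iso[OF g]) (use \<open>0 \<in> ?V\<close> in \<open>auto simp: pull_def\<close>)
    then show ?thesis using holds_iff_sat[OF p] by metis
  qed
  show "k \<le> Wstar (card V)" "k \<le> W (card V)"
    using Wstar_W_lower_bound[OF pull_graph[OF G(1)] _ pull_graph[OF H(1)], of k]
      G(2) H(2) width pull_col pull_holds by blast+
qed

section \<open>Expanding linear systems\<close>

definition parity :: "(nat \<times> nat \<Rightarrow> nat) \<Rightarrow> (nat \<Rightarrow> bool) \<Rightarrow> nat \<Rightarrow> bool" where
  "parity c g i \<longleftrightarrow> ((g (c (i, 0)) \<noteq> g (c (i, 1))) \<noteq> g (c (i, 2)))"

text \<open>Occurrences are counted, not equations: a variable standing twice in one equation
  cancels there and is not on the boundary.\<close>

definition boundary :: "(nat \<times> nat \<Rightarrow> nat) \<Rightarrow> nat set \<Rightarrow> nat set" where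
  "boundary c S = {x. card {p \<in> S \<times> {..<3}. c p = x} = 1}"

text \<open>The ratio 5/3 lies strictly between 3/2, above which boundaries have linear size, and 2,
  below which the union bound has slack.\<close>

definition expanding :: "(nat \<times> nat \<Rightarrow> nat) \<Rightarrow> nat \<Rightarrow> nat \<Rightarrow> bool" where
  "expanding c m r \<longleftrightarrow>
     (\<forall>S\<subseteq>{..<m}. S \<noteq> {} \<and> card S \<le> r \<longrightarrow> 5 * card S < 3 * card (c ` (S \<times> {..<3})))"

definition extends_to_solution ::
    "(nat \<times> nat \<Rightarrow> nat) \<Rightarrow> nat set \<Rightarrow> nat set \<Rightarrow> (nat \<Rightarrow> bool) \<Rightarrow> nat set \<Rightarrow> bool" where
  "extends_to_solution c B D f S \<longleftrightarrow>
     (\<exists>g. (\<forall>x\<in>D. g x = f x) \<and> (\<forall>i\<in>S. parity c g i = (i \<in> B)))"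

text \<open>Duplicator's invariant. \<open>B\<close> holds the equations with right-hand side 1. The
  whole system may be unsolvable, so consistency is asked only of each set of at most
  \<open>s\<close> equations, separately.\<close>

definition locally_consistent ::
    "(nat \<times> nat \<Rightarrow> nat) \<Rightarrow> nat \<Rightarrow> nat \<Rightarrow> nat set \<Rightarrow> nat set \<Rightarrow> (nat \<Rightarrow> bool) \<Rightarrow> bool" where
  "locally_consistent c m s B D f \<longleftrightarrow>
     (\<forall>S\<subseteq>{..<m}. card S \<le> s \<longrightarrow> extends_to_solution c B D f S)"

lemma finite_boundary:
  assumes "finite S" shows "finite (boundary c S)"
proof (rule finite_subset)
  show "boundary c S \<subseteq> c ` (S \<times> {..<3})"
  proof
    fix x assume "x \<in> boundary c S"
    then have "{p \<in> S \<times> {..<3}. c p = x} \<noteq> {}" unfolding boundary_def by force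
    then show "x \<in> c ` (S \<times> {..<3})" by blast
  qed
qed (use assms in simp)

text \<open>Double counting of the \<open>3 * card S\<close> occurrences: a boundary variable uses
  one, any other variable of \<open>S\<close> at least two.\<close>

lemma card_boundary_ge:
  assumes "finite S"
  shows "2 * card (c ` (S \<times> {..<3})) \<le> card (boundary c S) + 3 * card S"
proof -
  let ?P = "S \<times> {..<3 :: nat}"
  let ?occ = "\<lambda>x. card {p. p \<in> ?P \<and> c p = x}"
  have fin: "finite ?P" using assms by simp
  have occ: "2 \<le> ?occ x + (if x \<in> boundary c S then 1 else 0)" if x: "x \<in> c ` ?P" for x
  proof -
    have "{p. p \<in> ?P \<and> c p = x} \<noteq> {}" "finite {p. p \<in> ?P \<and> c p = x}" using x fin by auto
    then have "?occ x > 0" by (simp add: card_gt_0_iff)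
    moreover have "?occ x = 1 \<longleftrightarrow> x \<in> boundary c S" by (simp add: boundary_def)
    ultimately show ?thesis by auto
  qed
  have "2 * card (c ` ?P) = (\<Sum>x\<in>c ` ?P. 2)" by simp
  also have "\<dots> \<le> (\<Sum>x\<in>c ` ?P. ?occ x + (if x \<in> boundary c S then 1 else 0))"
    by (rule sum_mono) (rule occ)
  also have "\<dots> = (\<Sum>x\<in>c ` ?P. ?occ x) + card (c ` ?P \<inter> boundary c S)"
    using fin by (simp add: sum.distrib sum.If_cases)
  also have "(\<Sum>x\<in>c ` ?P. ?occ x) = card ?P"
    using sum.image_gen[OF fin, of "\<lambda>_. 1 :: nat" c] by simp
  also have "card (c ` ?P \<inter> boundary c S) \<le> card (boundary c S)"
    by (rule card_mono) (auto simp: finite_boundary assms)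
  finally show ?thesis by (simp add: card_cartesian_product)
qed

lemma parity_flip_boundary:
  assumes "x \<in> boundary c S"
  obtains i where "i \<in> S" "\<And>g. parity c (g(x := \<not> g x)) i = (\<not> parity c g i)"
    "\<And>g i'. i' \<in> S \<Longrightarrow> i' \<noteq> i \<Longrightarrow> parity c (g(x := \<not> g x)) i' = parity c g i'"
proof -
  obtain i j where ij: "{p \<in> S \<times> {..<3}. c p = x} = {(i, j)}"
    using assms by (auto simp: boundary_def card_1_singleton_iff)
  then have i: "i \<in> S" and j: "j < 3" and cx: "c (i, j) = x" by auto
  have uniq: "i' = i \<and> j' = j" if "i' \<in> S" "j' < 3" "c (i', j') = x" for i' j'
    using ij that by auto
  have other: "c (i', j') \<noteq> x" if "i' \<in> S" "j' < 3" "\<not> (i' = i \<and> j' = j)" for i' j'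
    using uniq that by blast
  show ?thesis
  proof
    show "i \<in> S" by (rule i)
    have "j = 0 \<or> j = 1 \<or> j = 2" using j by auto
    then show "parity c (g(x := \<not> g x)) i = (\<not> parity c g i)" for g
      using other[OF i, of 0] other[OF i, of 1] other[OF i, of 2] cx
      by (elim disjE) (auto simp: parity_def)
    show "parity c (g(x := \<not> g x)) i' = parity c g i'" if "i' \<in> S" "i' \<noteq> i" for g i'
      using other[OF that(1), of 0] other[OF that(1), of 1] other[OF that(1), of 2] that(2)
      by (auto simp: parity_def)
  qed
qed

text \<open>Take a minimal inconsistent subset. If it had a boundary variable outside
  \<open>D\<close>, the equation containing that variable could be dropped, the rest solved, and the
  dropped equation repaired by flipping the variable, which affects no other equation.\<close>

lemma inconsistent_core:
  assumes "finite S" "\<not> extends_to_solution c B D f S"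
  obtains S' where "S' \<subseteq> S" "\<not> extends_to_solution c B D f S'" "boundary c S' \<subseteq> D"
proof -
  have "\<exists>S'\<subseteq>S. \<not> extends_to_solution c B D f S' \<and> boundary c S' \<subseteq> D"
    using assms
  proof (induction S rule: finite_psubset_induct)
    case (psubset S)
    show ?case
    proof (cases "\<exists>T\<subset>S. \<not> extends_to_solution c B D f T")
      case True
      then obtain T where T: "T \<subset> S" "\<not> extends_to_solution c B D f T" by blast
      then show ?thesis using psubset.IH[OF T] by (meson psubset_imp_subset subset_trans)
    next
      case False
      have "boundary c S \<subseteq> D"
      proof (rule subsetI, rule ccontr)
        fix x assume x: "x \<in> boundary c S" "x \<notin> D"
        obtain i where i: "i \<in> S"
          and flip: "\<And>g. parity c (g(x := \<not> g x)) i = (\<not> parity c g i)"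
          and keep: "\<And>g i'. i' \<in> S \<Longrightarrow> i' \<noteq> i \<Longrightarrow> parity c (g(x := \<not> g x)) i' = parity c g i'"
          using parity_flip_boundary[OF x(1)] by metis
        have "extends_to_solution c B D f (S - {i})" using False i by blast
        then obtain g where g: "\<forall>y\<in>D. g y = f y" "\<forall>i'\<in>S - {i}. parity c g i' = (i' \<in> B)"
          by (auto simp only: extends_to_solution_def)
        define g' where "g' = (if parity c g i = (i \<in> B) then g else g(x := \<not> g x))"
        have "\<forall>y\<in>D. g' y = f y" using g(1) x(2) by (auto simp: g'_def)
        moreover have "\<forall>i'\<in>S. parity c g' i' = (i' \<in> B)"
        proof
          fix i' assume i': "i' \<in> S"
          show "parity c g' i' = (i' \<in> B)"
          proof (cases "i' = i")
            case True
            then show ?thesis using flip[of g] by (auto simp: g'_def)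
          next
            case False
            then show ?thesis using g(2) i' keep[OF i' False, of g] by (auto simp: g'_def)
          qed
        qed
        ultimately show False
          using psubset.prems unfolding extends_to_solution_def by blast
      qed
      then show ?thesis using psubset.prems by blast
    qed
  qed
  then show ?thesis using that by blast
qed

lemma expanding_boundary:
  assumes "expanding c m r" "S \<subseteq> {..<m}" "S \<noteq> {}" "card S \<le> r"
  shows "card S < 3 * card (boundary c S)"
proof -
  have "finite S" using assms(2) by (rule finite_subset) simp
  from card_boundary_ge[OF this, of c]
  have "2 * card (c ` (S \<times> {..<3})) \<le> card (boundary c S) + 3 * card S" .
  moreover have "5 * card S < 3 * card (c ` (S \<times> {..<3}))"
    using assms unfolding expanding_def by blast
  ultimately show ?thesis by linarith
qed

lemma extends_to_solution_empty: "extends_to_solution c B D f {}"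
  unfolding extends_to_solution_def by blast

text \<open>A contradiction would contain a nonempty core with empty boundary, against
  expansion.\<close>

lemma locally_consistent_empty:
  assumes "expanding c m (2 * s)"
  shows "locally_consistent c m s B {} f"
  unfolding locally_consistent_def
proof (intro allI impI, rule ccontr)
  fix S assume S: "S \<subseteq> {..<m}" "card S \<le> s" "\<not> extends_to_solution c B {} f S"
  have fin: "finite S" using S(1) by (rule finite_subset) simp
  obtain S' where S': "S' \<subseteq> S" "\<not> extends_to_solution c B {} f S'" "boundary c S' \<subseteq> {}"
    using inconsistent_core[OF fin S(3)] by blast
  have "S' \<noteq> {}" using S'(2) extends_to_solution_empty by metis
  moreover have "card S' \<le> 2 * s" using card_mono[OF fin S'(1)] S(2) by simp
  ultimately have "0 < card (boundary c S')"
    using expanding_boundary[OF assms, of S'] S'(1) S(1) by force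
  then show False using S'(3) by simp
qed

lemma locally_consistent_subset:
  assumes "locally_consistent c m s B D f" "D' \<subseteq> D"
  shows "locally_consistent c m s B D' f"
  unfolding locally_consistent_def
proof (intro allI impI)
  fix S assume "S \<subseteq> {..<m}" "card S \<le> s"
  then have "extends_to_solution c B D f S"
    using assms(1) unfolding locally_consistent_def by simp
  then show "extends_to_solution c B D' f S"
    using assms(2) unfolding extends_to_solution_def by (elim ex_forward) (simp add: subset_iff)
qed

lemma locally_consistent_parity:
  assumes "locally_consistent c m s B D f" "i < m" "1 \<le> s" "\<And>j. j < 3 \<Longrightarrow> c (i, j) \<in> D"
  shows "parity c f i = (i \<in> B)"
proof -
  have "extends_to_solution c B D f {i}"
    using assms(1-3) unfolding locally_consistent_def by simp
  then show ?thesis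
    using assms(4)[of 0] assms(4)[of 1] assms(4)[of 2]
    by (auto simp: extends_to_solution_def parity_def)
qed

text \<open>If both values of \<open>x\<close> were refuted by at most \<open>s\<close> equations, the union of the two
  refutations would contain a core of size between \<open>s\<close> and \<open>2 s\<close> that refutes \<open>f\<close>;
  by expansion its boundary is too large to fit into \<open>D\<close>.\<close>

lemma locally_consistent_extend:
  assumes exp: "expanding c m (2 * s)" and f: "locally_consistent c m s B D f"
    and D: "finite D" "3 * card D \<le> s"
  obtains b where "locally_consistent c m s B (insert x D) (f(x := b))"
proof (cases "x \<in> D")
  case True
  then show ?thesis using that[of "f x"] f by (simp add: insert_absorb)
next
  case x: False
  show ?thesis
  proof (rule ccontr)
    assume "\<not> thesis"
    then have "\<And>b. \<not> locally_consistent c m s B (insert x D) (f(x := b))" using that by blast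
    then have "\<exists>S\<subseteq>{..<m}. card S \<le> s \<and> \<not> extends_to_solution c B (insert x D) (f(x := b)) S" for b
      unfolding locally_consistent_def by blast
    then obtain S where S: "\<And>b. S b \<subseteq> {..<m}" "\<And>b. card (S b) \<le> s"
      and bad: "\<And>b. \<not> extends_to_solution c B (insert x D) (f(x := b)) (S b)"
      by metis
    let ?S = "S False \<union> S True"
    have sub: "?S \<subseteq> {..<m}" using S(1) by blast
    then have fin: "finite ?S" by (rule finite_subset) simp
    have "\<not> extends_to_solution c B D f ?S"
    proof
      assume "extends_to_solution c B D f ?S"
      then obtain g where g: "\<forall>y\<in>D. g y = f y" "\<forall>i\<in>?S. parity c g i = (i \<in> B)"
        by (auto simp only: extends_to_solution_def)
      have "S (g x) \<subseteq> ?S" by (cases "g x") auto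
      then have "extends_to_solution c B (insert x D) (f(x := g x)) (S (g x))"
        unfolding extends_to_solution_def using g by (intro exI[of _ g]) auto
      then show False using bad by blast
    qed
    then obtain S' where S': "S' \<subseteq> ?S" "\<not> extends_to_solution c B D f S'" "boundary c S' \<subseteq> D"
      using inconsistent_core[OF fin] by metis
    have "card S' \<le> card ?S" by (rule card_mono[OF fin S'(1)])
    also have "\<dots> \<le> 2 * s"
      using card_Un_le[of "S False" "S True"] S(2)[of False] S(2)[of True] by linarith
    finally have "card S' \<le> 2 * s" .
    moreover have "S' \<noteq> {}" using S'(2) extends_to_solution_empty by metis
    moreover have "S' \<subseteq> {..<m}" using S'(1) sub by blast
    ultimately have "card S' < 3 * card (boundary c S')"
      using expanding_boundary[OF exp] by blast
    moreover have "s < card S'"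
    proof (rule ccontr)
      assume "\<not> s < card S'"
      then have "card S' \<le> s" by simp
      then show False
        using f S'(2) \<open>S' \<subseteq> {..<m}\<close> unfolding locally_consistent_def by blast
    qed
    moreover have "card (boundary c S') \<le> card D" by (rule card_mono[OF D(1) S'(3)])
    ultimately show False using D(2) by linarith
  qed
qed

lemma locally_consistent_extend_set:
  assumes exp: "expanding c m (2 * s)" and T: "finite T"
    and "locally_consistent c m s B D f" "finite D" "3 * (card D + card T) \<le> s"
  shows "\<exists>f'. locally_consistent c m s B (T \<union> D) f' \<and> (\<forall>x\<in>D. f' x = f x)"
  using T assms(3-)
proof (induction T rule: finite_induct)
  case empty
  then show ?case by auto
next
  case (insert x T)
  then obtain f' where f': "locally_consistent c m s B (T \<union> D) f'" "\<forall>x\<in>D. f' x = f x" by auto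
  show ?case
  proof (cases "x \<in> D")
    case True
    then have "insert x T \<union> D = T \<union> D" by auto
    then show ?thesis using f' by auto
  next
    case False
    have "3 * card (T \<union> D) \<le> s" using card_Un_le[of T D] insert by auto
    then obtain b where "locally_consistent c m s B (insert x (T \<union> D)) (f'(x := b))"
      using locally_consistent_extend[OF exp f'(1)] insert by (metis finite_UnI)
    moreover have "\<forall>y\<in>D. (f'(x := b)) y = f y" using f'(2) False by auto
    ultimately show ?thesis by (metis Un_insert_left)
  qed
qed

text \<open>Pigeonhole: \<open>2 ^ N\<close> assignments realise at most \<open>2 ^ N\<close> of the
  \<open>2 ^ m\<close> right-hand sides.\<close>

lemma ex_unsolvable_rhs:
  assumes "N < m" and c: "\<And>i j. i < m \<Longrightarrow> j < 3 \<Longrightarrow> c (i, j) < N"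
  obtains B where "B \<subseteq> {..<m}" "\<And>g. \<exists>i<m. parity c g i \<noteq> (i \<in> B)"
proof -
  let ?F = "\<lambda>A. {i\<in>{..<m}. parity c (\<lambda>x. x \<in> A) i}"
  have "card (?F ` Pow {..<N}) \<le> 2 ^ N"
    using card_image_le[of "Pow {..<N}" ?F] by (simp add: card_Pow)
  also have "\<dots> < 2 ^ m" using assms(1) by simp
  also have "\<dots> = card (Pow {..<m})" by (simp add: card_Pow)
  finally have "?F ` Pow {..<N} \<noteq> Pow {..<m}" by auto
  moreover have "?F ` Pow {..<N} \<subseteq> Pow {..<m}" by auto
  ultimately obtain B where B: "B \<subseteq> {..<m}" "B \<notin> ?F ` Pow {..<N}" by blast
  have "\<exists>i<m. parity c g i \<noteq> (i \<in> B)" for g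
  proof (rule ccontr)
    assume "\<not> ?thesis"
    moreover have "parity c (\<lambda>x. x \<in> {x. x < N \<and> g x}) i = parity c g i" if "i < m" for i
      using c[OF that] by (simp add: parity_def)
    ultimately have "?F {x. x < N \<and> g x} = B" using B(1) by auto
    then show False using B(2) by blast
  qed
  then show ?thesis using that B(1) by blast
qed

section \<open>Existence of expanding systems\<close>

text \<open>A crude Stirling bound; the induction step is
  \<open>(1 + 1 / k) ^ k <= exp 1 <= 3\<close>.\<close>

lemma power_self_le_fact: "real k ^ k \<le> 3 ^ k * fact k"
proof (induction k)
  case (Suc k)
  have "real (Suc k) ^ k \<le> 3 * real k ^ k"
  proof (cases "k = 0")
    case False
    have "real (Suc k) ^ k = (1 + 1 / real k) ^ k * real k ^ k"
      using False by (simp add: field_simps flip: power_mult_distrib)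
    also have "(1 + 1 / real k) ^ k \<le> exp 1"
      using exp_ge_one_plus_x_over_n_power_n[of k 1] False by simp
    also have "exp 1 \<le> (3 :: real)" by (rule exp_le)
    finally show ?thesis by (simp add: mult_right_mono)
  qed simp
  then have "real (Suc k) ^ Suc k \<le> real (Suc k) * (3 * real k ^ k)"
    by (simp add: mult_left_mono del: of_nat_Suc)
  also have "\<dots> \<le> real (Suc k) * (3 * (3 ^ k * fact k))"
    using Suc by (intro mult_left_mono) auto
  finally show ?case by (simp add: algebra_simps)
qed simp

lemma binomial_le_power:
  assumes "0 < k" shows "real (n choose k) \<le> (3 * real n / real k) ^ k"
proof -
  have "real (n choose k) * real k ^ k \<le> real (n choose k) * (3 ^ k * fact k)"
    by (rule mult_left_mono[OF power_self_le_fact]) simp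
  also have "\<dots> = 3 ^ k * real ((n choose k) * fact k)" by simp
  also have "\<dots> \<le> 3 ^ k * real (n ^ k)"
    by (rule mult_left_mono) (use binomial_fact_pow[of n k] in \<open>simp_all only: of_nat_le_iff\<close>, simp)
  finally show ?thesis
    using assms by (simp add: power_divide power_mult_distrib pos_le_divide_eq)
qed

text \<open>Union bound over the sets of \<open>r\<close> equations and of \<open>q\<close> variables to which they
  could be confined. The slack \<open>2 r - q \<ge> r / 3\<close> yields a factor
  \<open>(q / N) powr (r / 3)\<close>, and \<open>10077696 = 216 ^ 3\<close> makes it beat the constant \<open>108 ^ r\<close>
  from the binomial coefficients.\<close>

lemma bad_systems_bound:
  fixes r N :: nat
  defines "q \<equiv> 5 * r div 3"
  assumes r: "0 < r" and rN: "20155392 * r \<le> N"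
  shows "real ((2 * N choose r) * (N choose q)) * (real q / real N) ^ (3 * r) \<le> (1 / 2) ^ r"
proof -
  have q: "0 < q" "q \<le> 2 * r" "r \<le> 3 * (2 * r - q)" using r by (auto simp: q_def)
  have N: "0 < N" using r rN by simp
  define y where "y = real q / real N"
  have y0: "0 < y" using q N by (simp add: y_def)
  have "10077696 * real q \<le> real N"
  proof -
    have "10077696 * q \<le> N" using q(2) rN by linarith
    then have "real (10077696 * q) \<le> real N" by (simp only: of_nat_le_iff)
    then show ?thesis by simp
  qed
  then have y: "y \<le> (1 / 216) ^ 3" using N by (simp add: y_def field_simps power3_eq_cube)
  have "real ((2 * N choose r) * (N choose q)) * y ^ (3 * r)
      \<le> ((3 * real (2 * N) / real r) ^ r * (3 * real N / real q) ^ q) * y ^ (3 * r)"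
    using binomial_le_power[OF r, of "2 * N"] binomial_le_power[OF q(1), of N] y0
    by (intro mult_right_mono) (auto intro!: mult_mono)
  also have "\<dots> = (3 * real (2 * N) / real r * y) ^ r * (3 * real N / real q * y) ^ q * y ^ (2 * r - q)"
  proof -
    \<comment> \<open>Of the \<open>3 * r\<close> factors \<open>y\<close>, \<open>r\<close> cancel
      \<open>N\<close> in the first binomial bound and \<open>q\<close> in the second; the other
      \<open>2 * r - q\<close> are the gain.\<close>
    have "3 * r = q + (r + (2 * r - q))" using q(2) by simp
    then have "y ^ (3 * r) = y ^ q * (y ^ r * y ^ (2 * r - q))" by (metis power_add)
    then show ?thesis by (simp only: power_mult_distrib mult_ac)
  qed
  also have "3 * real N / real q * y = 3" using q N by (simp add: y_def)
  also have "3 * real (2 * N) / real r * y = 6 * (real q / real r)" using N by (simp add: y_def)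
  also have "(6 * (real q / real r)) ^ r * 3 ^ q * y ^ (2 * r - q) \<le> 12 ^ r * 9 ^ r * (1 / 216) ^ r"
  proof (intro mult_mono)
    have "real q \<le> 2 * real r" using q(2) by linarith
    then have "6 * (real q / real r) \<le> 12" using r by (simp add: field_simps)
    then show "(6 * (real q / real r)) ^ r \<le> 12 ^ r" by (intro power_mono) auto
    have "(3 :: real) ^ q \<le> 3 ^ (2 * r)" using q(2) by (intro power_increasing) auto
    then show "(3 :: real) ^ q \<le> 9 ^ r" by (simp add: power_mult)
    have "y ^ (2 * r - q) \<le> ((1 / 216) ^ 3) ^ (2 * r - q)"
      using y y0 by (intro power_mono) auto
    also have "\<dots> = (1 / 216) ^ (3 * (2 * r - q))" by (simp add: power_mult)
    also have "\<dots> \<le> (1 / 216 :: real) ^ r" using q(3) by (intro power_decreasing) auto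
    finally show "y ^ (2 * r - q) \<le> (1 / 216) ^ r" .
  qed (use y0 in auto)
  also have "\<dots> = (1 / 2) ^ r" by (simp flip: power_mult_distrib)
  finally show ?thesis by (simp add: y_def)
qed

lemma sum_half_powers: "(\<Sum>r = 1..R. (1 / 2 :: real) ^ r) < 1"
proof -
  have "(\<Sum>r = 1..R. (1 / 2 :: real) ^ r) = 1 - (1 / 2) ^ R"
    by (induction R) auto
  then show ?thesis by simp
qed

text \<open>Positions are filled independently: those in \<open>S\<close> have \<open>card Q\<close>
  choices each, the others \<open>N\<close>.\<close>

lemma card_systems_confined:
  assumes "S \<subseteq> {..<m}" "Q \<subseteq> {..<N}"
  shows "card {c \<in> {..<m} \<times> {..<3 :: nat} \<rightarrow>\<^sub>E {..<N}. c ` (S \<times> {..<3}) \<subseteq> Q}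
    = card Q ^ (3 * card S) * N ^ (3 * (m - card S))"
proof -
  let ?P = "{..<m} \<times> {..<3 :: nat}" and ?SP = "S \<times> {..<3 :: nat}"
  have fS: "finite S" using assms(1) by (rule finite_subset) simp
  have "{c \<in> ?P \<rightarrow>\<^sub>E {..<N}. c ` ?SP \<subseteq> Q} = Pi\<^sub>E ?P (\<lambda>p. if p \<in> ?SP then Q else {..<N})"
  proof (intro set_eqI iffI)
    fix c assume "c \<in> Pi\<^sub>E ?P (\<lambda>p. if p \<in> ?SP then Q else {..<N})"
    then have c: "c \<in> extensional ?P" "\<And>p. p \<in> ?P \<Longrightarrow> c p \<in> (if p \<in> ?SP then Q else {..<N})"
      by (simp_all only: PiE_iff)
    have "c p \<in> {..<N}" if "p \<in> ?P" for p
      using c(2)[OF that] assms(2) by (auto split: if_splits)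
    moreover have "c p \<in> Q" if p: "p \<in> ?SP" for p
    proof -
      have "p \<in> ?P" using p assms(1) by blast
      from c(2)[OF this] show ?thesis using p by simp
    qed
    ultimately show "c \<in> {c \<in> ?P \<rightarrow>\<^sub>E {..<N}. c ` ?SP \<subseteq> Q}"
      using c(1) by (simp add: PiE_iff image_subset_iff)
  next
    fix c assume "c \<in> {c \<in> ?P \<rightarrow>\<^sub>E {..<N}. c ` ?SP \<subseteq> Q}"
    then show "c \<in> Pi\<^sub>E ?P (\<lambda>p. if p \<in> ?SP then Q else {..<N})"
      by (simp add: PiE_iff image_subset_iff)
  qed
  then have "card {c \<in> ?P \<rightarrow>\<^sub>E {..<N}. c ` ?SP \<subseteq> Q}
      = (\<Prod>p\<in>?P. card (if p \<in> ?SP then Q else {..<N}))"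
    by (simp only: card_PiE finite_cartesian_product finite_lessThan)
  also have "\<dots> = (\<Prod>p\<in>?P. if p \<in> ?SP then card Q else N)"
    by (rule prod.cong) auto
  also have "\<dots> = card Q ^ card (?P \<inter> ?SP) * N ^ card (?P \<inter> - ?SP)"
    by (simp add: prod.If_cases del: mem_Sigma_iff)
  also have "?P \<inter> ?SP = ?SP" using assms(1) by auto
  also have "?P \<inter> - ?SP = ({..<m} - S) \<times> {..<3}" by auto
  finally show ?thesis
    using assms(1) fS by (simp add: card_cartesian_product card_Diff_subset mult.commute)
qed

lemma ex_expanding_system:
  obtains c where "\<And>i j. i < 2 * N \<Longrightarrow> j < 3 \<Longrightarrow> c (i, j) < N"
    "expanding c (2 * N) (2 * (N div 40310784))"
proof (cases "N = 0")
  case True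
  then show ?thesis using that[of "\<lambda>_. 0"] by (simp add: expanding_def)
next
  case False
  let ?m = "2 * N" and ?q = "\<lambda>r. 5 * r div 3"
  \<comment> \<open>40310784 is twice 20155392, so every \<open>r <= R\<close> satisfies the size
    hypothesis of \<open>bad_systems_bound\<close>. The outer factor 2 provides the expansion up to
    \<open>2 * s\<close> that consistency at level \<open>s\<close> requires.\<close>
  define R where "R = 2 * (N div 40310784)"
  let ?\<Omega> = "{..<?m} \<times> {..<3 :: nat} \<rightarrow>\<^sub>E {..<N}"
  define sets where "sets n k = {S. S \<subseteq> {..<n} \<and> card S = k}" for n k :: nat
  have card_sets: "card (sets n k) = n choose k" for n k
    unfolding sets_def using n_subsets[of "{..<n}" k] by simp
  have fin_sets: "finite (sets n k)" for n k
    unfolding sets_def by (rule finite_subset[of _ "Pow {..<n}"]) auto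
  define confined where "confined S Q = {c \<in> ?\<Omega>. c ` (S \<times> {..<3}) \<subseteq> Q}" for S Q
  define bad where
    "bad r = (\<Union>(S, Q)\<in>sets ?m r \<times> sets N (?q r). confined S Q)" for r
  have \<Omega>: "finite ?\<Omega>" "card ?\<Omega> = N ^ (3 * ?m)"
    by (auto simp: finite_PiE card_PiE card_cartesian_product mult.commute)
  have rN: "20155392 * r \<le> N" if "r \<le> R" for r
    using that unfolding R_def by linarith
  have card_bad: "real (card (bad r)) \<le> (1 / 2) ^ r * real N ^ (3 * ?m)"
    if r: "r \<in> {1..R}" for r
  proof -
    have rm: "r \<le> ?m" using rN[of r] r by simp
    have "card (bad r) \<le> (\<Sum>(S, Q)\<in>sets ?m r \<times> sets N (?q r). card (confined S Q))"
      unfolding bad_def case_prod_unfold by (rule card_UN_le) (simp add: fin_sets)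
    also have "\<dots> = (\<Sum>(S, Q)\<in>sets ?m r \<times> sets N (?q r). ?q r ^ (3 * r) * N ^ (3 * (?m - r)))"
      by (rule sum.cong) (auto simp: sets_def confined_def card_systems_confined)
    also have "\<dots> = (?m choose r) * (N choose ?q r) * (?q r ^ (3 * r) * N ^ (3 * (?m - r)))"
      by (simp add: case_prod_unfold card_cartesian_product card_sets)
    finally have "real (card (bad r))
        \<le> real ((?m choose r) * (N choose ?q r) * (?q r ^ (3 * r) * N ^ (3 * (?m - r))))"
      by (simp only: of_nat_le_iff)
    also have "\<dots> = real ((?m choose r) * (N choose ?q r)) * (real (?q r) / real N) ^ (3 * r)
        * (real N ^ (3 * r) * real N ^ (3 * (?m - r)))"
      using False by (simp add: power_divide)
    also have "real N ^ (3 * r) * real N ^ (3 * (?m - r)) = real N ^ (3 * ?m)"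
    proof -
      have "3 * r + 3 * (?m - r) = 3 * ?m" using rm by simp
      then show ?thesis by (simp only: power_add[symmetric])
    qed
    also have "real ((?m choose r) * (N choose ?q r)) * (real (?q r) / real N) ^ (3 * r) \<le> (1 / 2) ^ r"
      by (rule bad_systems_bound) (use r rN in auto)
    finally show ?thesis by (simp add: mult_right_mono)
  qed
  have "real (card (\<Union>r\<in>{1..R}. bad r)) \<le> (\<Sum>r = 1..R. real (card (bad r)))"
    using card_UN_le[of "{1..R}" bad] by (simp flip: of_nat_sum)
  also have "\<dots> \<le> (\<Sum>r = 1..R. (1 / 2) ^ r * real N ^ (3 * ?m))"
    by (rule sum_mono) (rule card_bad)
  also have "\<dots> = (\<Sum>r = 1..R. (1 / 2) ^ r) * real N ^ (3 * ?m)"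
    by (simp add: sum_distrib_right)
  also have "\<dots> < 1 * real N ^ (3 * ?m)"
    using sum_half_powers False by (intro mult_strict_right_mono) auto
  also have "\<dots> = real (card ?\<Omega>)" using \<Omega>(2) by simp
  finally have "card (\<Union>r\<in>{1..R}. bad r) < card ?\<Omega>" by simp
  moreover have "finite (\<Union>r\<in>{1..R}. bad r)"
  proof -
    have "bad r \<subseteq> ?\<Omega>" for r unfolding bad_def confined_def by blast
    then show ?thesis using \<Omega>(1) by (meson UN_least finite_subset)
  qed
  ultimately obtain c where c: "c \<in> ?\<Omega>" "c \<notin> (\<Union>r\<in>{1..R}. bad r)"
    by (meson card_mono not_le subsetI)
  have "expanding c ?m R"
    unfolding expanding_def
  proof (intro allI impI, rule ccontr)
    fix S assume S: "S \<subseteq> {..<?m}" "S \<noteq> {} \<and> card S \<le> R"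
      "\<not> 5 * card S < 3 * card (c ` (S \<times> {..<3}))"
    let ?I = "c ` (S \<times> {..<3})"
    have "finite S" using S(1) by (rule finite_subset) simp
    then have r: "card S \<in> {1..R}" using S(2) by (auto simp: Suc_le_eq card_gt_0_iff)
    have "?I \<subseteq> {..<N}" using c(1) S(1) by (auto simp: PiE_iff)
    moreover have "card ?I \<le> ?q (card S)" using S(3) by linarith
    moreover have "?q (card S) \<le> card {..<N}" using rN[of "card S"] r by simp
    \<comment> \<open>The image may be smaller than \<open>?q (card S)\<close>; it is enlarged to
      exactly the size counted in \<open>bad\<close>.\<close>
    ultimately obtain Q where "?I \<subseteq> Q" "Q \<subseteq> {..<N}" "card Q = ?q (card S)"
      using exists_subset_between by (metis finite_lessThan)
    then have "c \<in> bad (card S)"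
      unfolding bad_def confined_def sets_def using S(1) c(1) by auto
    then show False using c(2) r by blast
  qed
  moreover have "c (i, j) < N" if "i < ?m" "j < 3" for i j
    using c(1) that by (auto simp: PiE_iff)
  ultimately show ?thesis using that unfolding R_def by blast
qed

section \<open>The graph of a linear system\<close>

text \<open>\<open>Lit x a\<close> is the literal \<open>x = a\<close>; the palette vertices 0, 1, 2 carry the
  colours true, false and neutral. For each \<open>i\<close> and \<open>t\<close>, the vertices \<open>Gad i t\<^sub>0 t\<^sub>1 t\<^sub>2 j\<close>
  with \<open>j < 5\<close> form the standard gadget for the clause of the three literals
  \<open>c (i, k) = t\<^sub>k\<close>. It is wired up only if \<open>t\<close> has the parity required by equation \<open>i\<close>,
  because the clause excludes just the complement of \<open>t\<close>. The isolated \<open>Pad\<close> vertices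
  adjust the order of the graph.\<close>

datatype vertex = Pal nat | Lit nat bool | Gad nat bool bool bool nat | Pad nat

inductive arc :: "(nat \<times> nat \<Rightarrow> nat) \<Rightarrow> nat set \<Rightarrow> vertex \<Rightarrow> vertex \<Rightarrow> bool" for c B where
  "p \<noteq> q \<Longrightarrow> arc c B (Pal p) (Pal q)"
| "arc c B (Lit x a) (Lit x (\<not> a))"
| "arc c B (Lit x a) (Pal 2)"
| "((t0 \<noteq> t1) \<noteq> t2) = (i \<in> B) \<Longrightarrow> arc c B (Gad i t0 t1 t2 0) (Lit (c (i, 0)) t0)"
| "((t0 \<noteq> t1) \<noteq> t2) = (i \<in> B) \<Longrightarrow> arc c B (Gad i t0 t1 t2 1) (Lit (c (i, 1)) t1)"
| "((t0 \<noteq> t1) \<noteq> t2) = (i \<in> B) \<Longrightarrow> arc c B (Gad i t0 t1 t2 4) (Lit (c (i, 2)) t2)"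
| "((t0 \<noteq> t1) \<noteq> t2) = (i \<in> B) \<Longrightarrow> (j, k) \<in> {(0, 1), (0, 2), (1, 2), (2, 3), (3, 4)} \<Longrightarrow>
     arc c B (Gad i t0 t1 t2 j) (Gad i t0 t1 t2 k)"
| "((t0 \<noteq> t1) \<noteq> t2) = (i \<in> B) \<Longrightarrow> j \<in> {3, 4} \<Longrightarrow> arc c B (Gad i t0 t1 t2 j) (Pal 0)"

text \<open>All eight sign patterns are present, wired or not, so that every right-hand side gives
  the same vertex set and flips permute it.\<close>

definition verts :: "nat \<Rightarrow> nat \<Rightarrow> nat \<Rightarrow> vertex set" where
  "verts N m r = Pal ` {..<3} \<union> (\<lambda>(x, a). Lit x a) ` ({..<N} \<times> UNIV)
     \<union> (\<lambda>(i, t0, t1, t2, j). Gad i t0 t1 t2 j) ` ({..<m} \<times> UNIV \<times> UNIV \<times> UNIV \<times> {..<5})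
     \<union> Pad ` {..<r}"

text \<open>\<open>arc\<close> is oriented so that every arc at a gadget starts in a gadget of the
  same equation; conditions on the equation then concern the source only. Symmetry and the
  restriction to \<open>V\<close> are imposed here.\<close>

definition edge :: "(nat \<times> nat \<Rightarrow> nat) \<Rightarrow> nat set \<Rightarrow> vertex set \<Rightarrow> vertex \<Rightarrow> vertex \<Rightarrow> bool" where
  "edge c B V u v \<longleftrightarrow> u \<in> V \<and> v \<in> V \<and> (arc c B u v \<or> arc c B v u)"

lemma verts_iff [simp]:
  "Pal p \<in> verts N m r \<longleftrightarrow> p < 3"
  "Lit x a \<in> verts N m r \<longleftrightarrow> x < N"
  "Gad i t0 t1 t2 j \<in> verts N m r \<longleftrightarrow> i < m \<and> j < 5"
  "Pad l \<in> verts N m r \<longleftrightarrow> l < r"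
  by (auto simp: verts_def image_iff)

lemma finite_verts: "finite (verts N m r)"
  by (simp add: verts_def)

lemma card_verts: "card (verts N m r) = 3 + 2 * N + 40 * m + r"
proof -
  let ?P = "Pal ` {..<3}" and ?L = "(\<lambda>(x, a). Lit x a) ` ({..<N} \<times> UNIV)"
    and ?G = "(\<lambda>(i, t0, t1, t2, j). Gad i t0 t1 t2 j) ` ({..<m} \<times> UNIV \<times> UNIV \<times> UNIV \<times> {..<5})"
    and ?R = "Pad ` {..<r}"
  have "card ?P = 3" by (subst card_image) (auto simp: inj_on_def)
  moreover have "card ?L = 2 * N"
    by (subst card_image) (auto simp: inj_on_def card_cartesian_product)
  moreover have "card ?G = 40 * m"
    by (subst card_image) (auto simp: inj_on_def card_cartesian_product)
  moreover have "card ?R = r" by (subst card_image) (auto simp: inj_on_def)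
  moreover have "card (?P \<union> ?L) = card ?P + card ?L"
    by (rule card_Un_disjoint) auto
  moreover have "card (?P \<union> ?L \<union> ?G) = card (?P \<union> ?L) + card ?G"
    by (rule card_Un_disjoint) auto
  moreover have "card (?P \<union> ?L \<union> ?G \<union> ?R) = card (?P \<union> ?L \<union> ?G) + card ?R"
    by (rule card_Un_disjoint) auto
  ultimately show ?thesis by (simp add: verts_def)
qed

lemma is_graph_edge: "is_graph (verts N m r) (edge c B (verts N m r))"
proof -
  have "\<not> arc c B u u" for u
  proof
    assume "arc c B u u" then show False by cases auto
  qed
  then show ?thesis by (auto simp: is_graph_def edge_def finite_verts)
qed

lemma third_colour:
  fixes a b d x :: nat
  assumes "a < 3" "b < 3" "d < 3" "x < 3" "a \<noteq> b" "a \<noteq> d" "b \<noteq> d" "x \<noteq> a" "x \<noteq> b"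
  shows "x = d"
  using assms by linarith

lemma colouring_solves_system:
  assumes col: "colorable (verts N m r) (edge c B (verts N m r)) 3"
    and c: "\<And>i j. i < m \<Longrightarrow> j < 3 \<Longrightarrow> c (i, j) < N"
  shows "\<exists>g. \<forall>i<m. parity c g i = (i \<in> B)"
proof -
  obtain k :: "vertex \<Rightarrow> nat" where k: "\<And>v. v \<in> verts N m r \<Longrightarrow> k v < 3"
    and ke: "\<And>u v. edge c B (verts N m r) u v \<Longrightarrow> k u \<noteq> k v"
    using col unfolding colorable_def edge_def by blast
  have ka: "k u \<noteq> k v" if "u \<in> verts N m r" "v \<in> verts N m r" "arc c B u v" for u v
    using ke that unfolding edge_def by blast
  have "k (Pal p) \<noteq> k (Pal q)" if "p < 3" "q < 3" "p \<noteq> q" for p q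
    by (rule ka) (use that in \<open>auto intro: arc.intros\<close>)
  then have pal: "k (Pal 0) < 3" "k (Pal 1) < 3" "k (Pal 2) < 3"
    "k (Pal 0) \<noteq> k (Pal 1)" "k (Pal 0) \<noteq> k (Pal 2)" "k (Pal 1) \<noteq> k (Pal 2)"
    by (simp_all add: k)
  define g where "g x \<longleftrightarrow> k (Lit x True) = k (Pal 0)" for x
  have false_lit: "k (Lit x (\<not> g x)) = k (Pal 1)" if x: "x < N" for x
  proof -
    have tf: "k (Lit x True) \<noteq> k (Lit x False)"
      using ka[of "Lit x True" "Lit x False"] arc.intros(2)[of c B x True] x by simp
    have neutral: "k (Lit x a) \<noteq> k (Pal 2)" for a
      by (rule ka) (use x in \<open>auto intro: arc.intros\<close>)
    show ?thesis
    proof (cases "g x")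
      case True
      then show ?thesis
        using third_colour[of "k (Pal 0)" "k (Pal 2)" "k (Pal 1)" "k (Lit x False)"]
          pal tf neutral[of False] k[of "Lit x False"] x by (simp add: g_def)
    next
      case False
      then show ?thesis
        using third_colour[of "k (Pal 0)" "k (Pal 2)" "k (Pal 1)" "k (Lit x True)"]
          pal neutral[of True] k[of "Lit x True"] x by (simp add: g_def)
    qed
  qed
  have "parity c g i = (i \<in> B)" if i: "i < m" for i
  proof (rule ccontr)
    assume bad: "parity c g i \<noteq> (i \<in> B)"
    \<comment> \<open>The pattern whose three literals are all false under \<open>g\<close>.
      Negating three bits negates their sum, so exactly when equation \<open>i\<close> fails does
      \<open>t\<close> have the parity for which the gadget is wired.\<close>
    define t where "t j \<longleftrightarrow> \<not> g (c (i, j))" for j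
    have t: "((t 0 \<noteq> t 1) \<noteq> t 2) = (i \<in> B)" using bad by (auto simp: parity_def t_def)
    have lit: "k (Lit (c (i, j)) (t j)) = k (Pal 1)" if "j < 3" for j
      using false_lit[OF c[OF i that]] by (simp add: t_def)
    let ?x = "\<lambda>j. k (Gad i (t 0) (t 1) (t 2) j)"
    have x3: "?x j < 3" if "j < 5" for j using i that by (simp add: k)
    have cc: "c (i, 0) < N" "c (i, 1) < N" "c (i, 2) < N" using c[OF i] by auto
    have "?x 0 \<noteq> k (Pal 1)" "?x 1 \<noteq> k (Pal 1)" "?x 4 \<noteq> k (Pal 1)"
      using ka[OF _ _ arc.intros(4)[OF t, of c]] ka[OF _ _ arc.intros(5)[OF t, of c]]
        ka[OF _ _ arc.intros(6)[OF t, of c]] lit[of 0] lit[of 1] lit[of 2] i cc by auto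
    moreover have "?x 0 \<noteq> ?x 1" "?x 0 \<noteq> ?x 2" "?x 1 \<noteq> ?x 2" "?x 2 \<noteq> ?x 3" "?x 3 \<noteq> ?x 4"
      by (rule ka; (rule arc.intros(7)[OF t])?; use i in simp)+
    moreover have "?x 3 \<noteq> k (Pal 0)" "?x 4 \<noteq> k (Pal 0)"
      by (rule ka; (rule arc.intros(8)[OF t])?; use i in simp)+
    \<comment> \<open>Vertices 0 and 1 use up the colours true and neutral, so 2 is false and 3
      neutral. Vertex 4 is neutral as well, although 3 and 4 are adjacent.\<close>
    moreover have "?x 2 = k (Pal 1)" and "?x 3 = k (Pal 2)" and "?x 4 = k (Pal 2)"
      if "?x 0 \<noteq> k (Pal 1)" "?x 1 \<noteq> k (Pal 1)" "?x 4 \<noteq> k (Pal 1)"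
        "?x 0 \<noteq> ?x 1" "?x 0 \<noteq> ?x 2" "?x 1 \<noteq> ?x 2" "?x 2 \<noteq> ?x 3"
        "?x 3 \<noteq> k (Pal 0)" "?x 4 \<noteq> k (Pal 0)"
    proof -
      show x2: "?x 2 = k (Pal 1)"
        by (rule third_colour[of "?x 0" "?x 1"]) (use that pal x3 in auto)
      show "?x 3 = k (Pal 2)"
        by (rule third_colour[of "k (Pal 0)" "k (Pal 1)"]) (use that x2 pal x3 in auto)
      show "?x 4 = k (Pal 2)"
        by (rule third_colour[of "k (Pal 0)" "k (Pal 1)"]) (use that pal x3 in auto)
    qed
    ultimately show False by metis
  qed
  then show ?thesis by blast
qed

lemma homogeneous_colorable: "colorable (verts N m r) (edge c {} (verts N m r)) 3"
proof -
  \<comment> \<open>The zero solution: \<open>Lit x True\<close> gets the colour of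
    \<open>Pal 1\<close>, false. The three lists serve the four wired patterns, those of even
    parity: 110, then 101, then 000 and 011 together.\<close>
  define k :: "vertex \<Rightarrow> nat" where
    "k v = (case v of Pal p \<Rightarrow> p | Lit x a \<Rightarrow> (if a then 1 else 0)
       | Gad i t0 t1 t2 j \<Rightarrow>
           (if t0 \<and> t1 then [0, 2, 1, 2, 1] else if t0 then [2, 1, 0, 1, 2] else [1, 2, 0, 1, 2]) ! j
       | Pad l \<Rightarrow> 0)" for v
  have "k u \<noteq> k v" if "arc c {} u v" for u v
    using that by cases (auto simp: k_def)
  moreover have "k v < 3" if "v \<in> verts N m r" for v
    using that by (cases v) (auto simp: k_def less_Suc_eq numeral_eq_Suc)
  ultimately show ?thesis
    unfolding colorable_def edge_def by (metis (no_types))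
qed

section \<open>Flips of variables and Duplicator's strategy\<close>

fun flip :: "(nat \<times> nat \<Rightarrow> nat) \<Rightarrow> (nat \<Rightarrow> bool) \<Rightarrow> vertex \<Rightarrow> vertex" where
  "flip c f (Lit x a) = Lit x (a \<noteq> f x)"
| "flip c f (Gad i t0 t1 t2 j) =
     Gad i (t0 \<noteq> f (c (i, 0))) (t1 \<noteq> f (c (i, 1))) (t2 \<noteq> f (c (i, 2))) j"
| "flip c f v = v"

text \<open>The variables whose values determine how a flip moves the vertex; at most three per
  pebble.\<close>

fun scope :: "(nat \<times> nat \<Rightarrow> nat) \<Rightarrow> vertex \<Rightarrow> nat set" where
  "scope c (Lit x a) = {x}"
| "scope c (Gad i t0 t1 t2 j) = {c (i, 0), c (i, 1), c (i, 2)}"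
| "scope c v = {}"

lemma finite_scope: "finite (scope c v)" and card_scope: "card (scope c v) \<le> 3"
  by (cases v; simp add: card_insert_le_m1)+

lemma flip_flip [simp]: "flip c f (flip c f v) = v"
  by (cases v) auto

lemma flip_eq_iff: "flip c f u = flip c f v \<longleftrightarrow> u = v"
  by (metis flip_flip)

lemma flip_in_verts [simp]: "flip c f v \<in> verts N m r \<longleftrightarrow> v \<in> verts N m r"
  by (cases v) auto

lemma scope_flip [simp]: "scope c (flip c f v) = scope c v"
  by (cases v) auto

lemma flip_cong: "(\<And>x. x \<in> scope c v \<Longrightarrow> f x = f' x) \<Longrightarrow> flip c f v = flip c f' v"
  by (cases v) auto

text \<open>The flip changes the parity of a sign pattern of equation \<open>i\<close> by
  \<open>parity c f i\<close>, so wired gadgets go to wired gadgets once the right-hand side is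
  shifted alike.\<close>

lemma arc_flip:
  assumes "arc c B u v"
    and "\<And>i t0 t1 t2 j. u = Gad i t0 t1 t2 j \<Longrightarrow> (i \<in> B') = ((i \<in> B) \<noteq> parity c f i)"
  shows "arc c B' (flip c f u) (flip c f v)"
proof -
  have shift: "(((t0 \<noteq> f (c (i, 0))) \<noteq> (t1 \<noteq> f (c (i, 1)))) \<noteq> (t2 \<noteq> f (c (i, 2)))) = (i \<in> B')"
    if "u = Gad i t0 t1 t2 j" "((t0 \<noteq> t1) \<noteq> t2) = (i \<in> B)" for i t0 t1 t2 j
    using that(2) assms(2)[OF that(1)] by (auto simp: parity_def)
  show ?thesis
    using assms(1)
  proof cases
    case (2 x a)
    then show ?thesis using arc.intros(2)[of c B' x "a \<noteq> f x"] by (simp add: eq_commute)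
  next
    case (4 t0 t1 t2 i)
    show ?thesis
      unfolding 4(1,2) flip.simps by (rule arc.intros(4)[OF shift[OF 4(1,3)]])
  next
    case (5 t0 t1 t2 i)
    show ?thesis
      unfolding 5(1,2) flip.simps by (rule arc.intros(5)[OF shift[OF 5(1,3)]])
  next
    case (6 t0 t1 t2 i)
    show ?thesis
      unfolding 6(1,2) flip.simps by (rule arc.intros(6)[OF shift[OF 6(1,3)]])
  next
    case (7 t0 t1 t2 i j k)
    show ?thesis
      unfolding 7(1,2) flip.simps by (rule arc.intros(7)[OF shift[OF 7(1,3)] 7(4)])
  next
    case (8 t0 t1 t2 i j)
    show ?thesis
      unfolding 8(1,2) flip.simps by (rule arc.intros(8)[OF shift[OF 8(1,3)] 8(4)])
  qed (auto intro: arc.intros)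
qed

lemma arc_flip_iff:
  assumes "\<And>i t0 t1 t2 j. u = Gad i t0 t1 t2 j \<Longrightarrow> parity c f i = (i \<in> B)"
  shows "arc c B u v = arc c {} (flip c f u) (flip c f v)"
proof
  show "arc c {} (flip c f u) (flip c f v)" if "arc c B u v"
    by (rule arc_flip[OF that]) (use assms in auto)
  show "arc c B u v" if "arc c {} (flip c f u) (flip c f v)"
  proof -
    \<comment> \<open>The flip is an involution, so the converse is \<open>arc_flip\<close> with
      \<open>B\<close> and the empty set exchanged.\<close>
    have "arc c B (flip c f (flip c f u)) (flip c f (flip c f v))"
    proof (rule arc_flip[OF that])
      fix i t0 t1 t2 j assume "flip c f u = Gad i t0 t1 t2 j"
      then show "(i \<in> B) = ((i \<in> {}) \<noteq> parity c f i)" using assms by (cases u) auto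
    qed
    then show ?thesis by simp
  qed
qed

text \<open>Duplicator's strategy: two pebbled positions correspond under the flip by a locally
  consistent assignment of the variables in the scopes of the pebbled vertices.\<close>

lemma sat_flip_invariant:
  fixes N m r s B
  defines "V \<equiv> verts N m r"
  assumes exp: "expanding c m (2 * s)" and s: "9 * card (vars p) \<le> s" "1 \<le> s"
    and a: "\<And>x. a x = Pal 0"
  shows "sat V (edge c B V) a p = sat V (edge c {} V) a p"
proof -
  let ?X = "vars p"
  let ?D = "\<lambda>a Y. \<Union>x\<in>Y. scope c (a x)"
  define R where "R a b \<longleftrightarrow> (\<forall>x\<in>?X. a x \<in> V) \<and>
      (\<exists>f. locally_consistent c m s B (?D a ?X) f \<and> (\<forall>x\<in>?X. b x = flip c f (a x)))"
    for a b :: "nat \<Rightarrow> vertex"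
  \<comment> \<open>Quantifying over all \<open>u\<close> with the scope of \<open>v\<close> serves
    both directions: when Spoiler plays \<open>w\<close> on the right, the answer
    \<open>flip c f w\<close> depends on an \<open>f\<close> not yet chosen, but its scope is
    already that of \<open>w\<close>.\<close>
  have respond: "\<exists>f. \<forall>u\<in>V. scope c u = scope c v \<longrightarrow> R (a(x := u)) (b(x := flip c f u))"
    if R: "R a b" and x: "x \<in> ?X" for a b x v
  proof -
    obtain f where aV: "\<forall>x\<in>?X. a x \<in> V" and f: "locally_consistent c m s B (?D a ?X) f"
      and b: "\<forall>x\<in>?X. b x = flip c f (a x)"
      using R unfolding R_def by auto
    let ?Y = "?X - {x}"
    have "card (?D a ?Y) \<le> (\<Sum>y\<in>?Y. card (scope c (a y)))"
      by (rule card_UN_le) (simp add: finite_vars)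
    also have "\<dots> \<le> card ?Y * 3"
      using sum_bounded_above[of ?Y "\<lambda>y. card (scope c (a y))" 3] by (simp add: card_scope)
    finally have "card (?D a ?Y) \<le> card ?Y * 3" .
    moreover have "card (scope c v) \<le> 3" by (rule card_scope)
    moreover have "card ?Y + 1 = card ?X" using card_Suc_Diff1[OF finite_vars x] by simp
    \<comment> \<open>Three variables per pebble, times the 3 lost in the boundary bound, give the
      factor 9.\<close>
    ultimately have "3 * card (?D a ?Y) + 3 * card (scope c v) \<le> s" using s(1) by linarith
    then have "3 * (card (?D a ?Y) + card (scope c v)) \<le> s" by simp
    moreover have "locally_consistent c m s B (?D a ?Y) f"
      by (rule locally_consistent_subset[OF f]) blast
    moreover have "finite (?D a ?Y)" by (simp add: finite_vars finite_scope)
    ultimately obtain f' where f': "locally_consistent c m s B (scope c v \<union> ?D a ?Y) f'"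
        "\<forall>z\<in>?D a ?Y. f' z = f z"
      using locally_consistent_extend_set[OF exp finite_scope[of c v], of B "?D a ?Y" f] by blast
    have "R (a(x := u)) (b(x := flip c f' u))" if u: "u \<in> V" "scope c u = scope c v" for u
      unfolding R_def
    proof (intro conjI exI ballI)
      have "?D (a(x := u)) ?X = scope c v \<union> ?D a ?Y"
        using x u(2) by (auto split: if_splits)
      then show "locally_consistent c m s B (?D (a(x := u)) ?X) f'" using f'(1) by simp
      fix y assume y: "y \<in> ?X"
      then show "(a(x := u)) y \<in> V" using aV u(1) by simp
      show "(b(x := flip c f' u)) y = flip c f' ((a(x := u)) y)"
      proof (cases "y = x")
        case False
        then have "flip c f (a y) = flip c f' (a y)"
          using y f'(2) by (intro flip_cong) (metis Diff_iff UN_I singletonD)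
        then show ?thesis using b y False by simp
      qed simp
    qed
    then show ?thesis by blast
  qed
  show ?thesis
  proof (rule sat_back_and_forth[where R = R and X = ?X])
    show "R a a"
      unfolding R_def using a locally_consistent_empty[OF exp] by (simp add: V_def)
    show "(a x = a y) = (b x = b y)" if "R a b" "x \<in> ?X" "y \<in> ?X" for a b x y
      using that by (auto simp: R_def flip_eq_iff)
    show "edge c B V (a x) (a y) = edge c {} V (b x) (b y)"
      if "R a b" and xy: "x \<in> ?X" "y \<in> ?X" for a b x y
    proof -
      obtain f where aV: "\<forall>x\<in>?X. a x \<in> V" and f: "locally_consistent c m s B (?D a ?X) f"
        and b: "\<forall>x\<in>?X. b x = flip c f (a x)"
        using \<open>R a b\<close> unfolding R_def by auto
      have "parity c f i = (i \<in> B)" if "z \<in> ?X" "a z = Gad i t0 t1 t2 j" for z i t0 t1 t2 j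
      proof (rule locally_consistent_parity[OF f _ s(2)])
        have "Gad i t0 t1 t2 j \<in> V" using aV that by metis
        then show "i < m" by (simp add: V_def)
        fix l :: nat assume "l < 3"
        then have "c (i, l) \<in> scope c (a z)"
          using that(2) by (auto simp: less_Suc_eq numeral_eq_Suc)
        then show "c (i, l) \<in> ?D a ?X" using that(1) by blast
      qed
      then have "arc c B (a z) v = arc c {} (flip c f (a z)) (flip c f v)" if "z \<in> ?X" for z v
        using that arc_flip_iff by metis
      then show ?thesis
        using b xy by (simp add: edge_def V_def)
    qed
    show "\<exists>w\<in>V. R (a(x := v)) (b(x := w))" if "R a b" "x \<in> ?X" "v \<in> V" for a b x v
      using respond[OF that(1,2), of v] that(3) by (metis V_def flip_in_verts)
    show "\<exists>v\<in>V. R (a(x := v)) (b(x := w))" if "R a b" "x \<in> ?X" "w \<in> V" for a b x w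
    proof -
      from respond[OF that(1,2), of w]
      obtain f where "\<forall>u\<in>V. scope c u = scope c w \<longrightarrow> R (a(x := u)) (b(x := flip c f u))"
        by blast
      moreover have "flip c f w \<in> V" using that(3) by (simp add: V_def)
      ultimately have "R (a(x := flip c f w)) (b(x := w))"
        by (metis flip_flip scope_flip)
      then show ?thesis using \<open>flip c f w \<in> V\<close> by blast
    qed
  qed simp
qed

section \<open>The linear lower bound\<close>

lemma Wstar_W_linear:
  fixes N r :: nat
  defines "s \<equiv> N div 40310784" and "n \<equiv> 3 + 82 * N + r"
  assumes N: "0 < N"
  shows "s div 9 + 1 \<le> Wstar n" "s div 9 + 1 \<le> W n"
proof -
  let ?m = "2 * N"
  obtain c where c: "\<And>i j. i < ?m \<Longrightarrow> j < 3 \<Longrightarrow> c (i, j) < N" and exp: "expanding c ?m (2 * s)"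
    using ex_expanding_system[of N] unfolding s_def by metis
  have "N < ?m" using N by simp
  then obtain B where B: "\<And>g. \<exists>i<?m. parity c g i \<noteq> (i \<in> B)"
    using ex_unsolvable_rhs[of N ?m c] c by metis
  let ?V = "verts N ?m r"
  have card: "card ?V = n" by (simp add: card_verts n_def)
  have not_col: "\<not> colorable ?V (edge c B ?V) 3"
    using colouring_solves_system[of N ?m r c B] c B by metis
  have width: "s div 9 + 1 \<le> width p"
    if p: "sentence p" "holds ?V (edge c B ?V) p" "\<not> holds ?V (edge c {} ?V) p" for p
  proof (rule ccontr)
    assume less: "\<not> s div 9 + 1 \<le> width p"
    \<comment> \<open>For small \<open>N\<close> the level \<open>s\<close> may be 0. A sentence
      without variables separates nothing, so here \<open>1 <= card (vars p)\<close>, and with it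
      \<open>1 <= s\<close>.\<close>
    have "vars p \<noteq> {}"
    proof
      assume "vars p = {}"
      then have "sat ?V (edge c B ?V) a p = sat ?V (edge c {} ?V) a p" for a
        by (intro sat_back_and_forth[where X = "{}" and R = "\<lambda>_ _. True"]) auto
      then show False using p holds_iff_sat by metis
    qed
    then have "1 \<le> card (vars p)" using finite_vars[of p] by (simp add: Suc_le_eq card_gt_0_iff)
    moreover have "9 * card (vars p) \<le> s" using less by (simp add: width_def)
    ultimately have "sat ?V (edge c B ?V) (\<lambda>_. Pal 0) p = sat ?V (edge c {} ?V) (\<lambda>_. Pal 0) p"
      by (intro sat_flip_invariant[OF exp]) auto
    then show False using p holds_iff_sat by metis
  qed
  show "s div 9 + 1 \<le> Wstar n" "s div 9 + 1 \<le> W n"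
    unfolding card[symmetric]
    by (rule Wstar_W_lower_bound_iso[OF is_graph_edge not_col is_graph_edge
          homogeneous_colorable[of N ?m r c]], rule width; assumption)+
qed

theorem theorem1:
  shows "(\<exists>c::real. c > 0 \<and> (\<exists>N. \<forall>n\<ge>N. real (Wstar n) \<ge> c * real n))
       \<and> (\<exists>c::real. c > 0 \<and> (\<exists>N. \<forall>n\<ge>N. real (W n) \<ge> c * real n))"
proof -
  define K where "K = (9 * 40310784 :: nat)"
  \<comment> \<open>There are 82 vertices per variable: 2 literals and two equations with 40 gadget
    vertices each. The factor 164 absorbs rounding, since \<open>n >= 170\<close> gives
    \<open>N >= 2\<close> and so \<open>n <= 82 * N + 84 <= 164 * N\<close>.\<close>
  define c where "c = 1 / (164 * real K)"
  have "c * real n \<le> real (Wstar n)" "c * real n \<le> real (W n)" if n: "170 \<le> n" for n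
  proof -
    define N where "N = (n - 3) div 82"
    define k where "k = N div K + 1"
    have N: "n \<le> 164 * N" "0 < N" using n unfolding N_def by linarith+
    have n_eq: "n = 3 + 82 * N + (n - 3 - 82 * N)"
      using n times_div_less_eq_dividend[of 82 "n - 3"] unfolding N_def by linarith
    have "N div 40310784 div 9 = N div K"
      by (simp add: K_def div_mult2_eq[symmetric])
    then have W: "k \<le> Wstar n" "k \<le> W n"
      using Wstar_W_linear[OF N(2), of "n - 3 - 82 * N"] unfolding k_def n_eq[symmetric] by simp_all
    have "N \<le> K * k"
      using dividend_less_times_div[of K N] by (simp add: k_def K_def)
    then have "n \<le> 164 * K * k" using N(1) by linarith
    then have "real n \<le> real (164 * K * k)" by (simp only: of_nat_le_iff)
    then have "c * real n \<le> real k" by (simp add: c_def K_def field_simps)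
    with W show "c * real n \<le> real (Wstar n)" "c * real n \<le> real (W n)" by linarith+
  qed
  moreover have "c > 0" by (simp add: c_def K_def)
  ultimately show ?thesis by blast
qed

end
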